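(* Let $E$ be a ground set with $|E|=n$, let $f_1,\dots,f_N:2^E\to\mathbb{R}_{\ge0}$ be monotone submodular with $f_i(\emptyset)=0$, let $F=\sum_{i=1}^Nf_i$, let $\mathcal{M}=(E,\mathcal{I})$ be a matroid of rank $r$, and $\texttt{OPT}=\max_{S\in\mathcal{I}}F(S)$. For every $\varepsilon\in(0,1)$, with an appropriate choice of $\kappa=\tilde O(rn/\varepsilon^2)$, Algorithm Federated Discrete Greedy returns, with probability at least $1-1/n$, a set $S\in\mathcal{I}$ with $(1/2-\varepsilon)\texttt{OPT}\le F(S)$. If $\mathcal{M}$ is a uniform matroid (cardinality constraint), then with probability at least $1-1/n$ it returns $S\in\mathcal{I}$ with $(1-1/\mathrm{e}-\varepsilon)\texttt{OPT}\le F(S)$. Moreover, in expectation, at each round $\tilde O(rn^2/\varepsilon^2)$ clients participate (send their vector).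
   Context: Importance factor of client $i$: $w_i=\max_{e\in E}\frac{f_i(\{e\})}{F(\{e\})}$. Algorithm Federated Discrete Greedy: set $S=\emptyset$. For $t=0,\dots,r-1$: the server sends $S$ to all clients; each client $i$ sets $\kappa_i=\min\{\kappa w_i,1\}$, computes $\Delta_i[e]=(f_i(S\cup\{e\})-f_i(S))/\kappa_i$ for all $e$ with $S\cup\{e\}\in\mathcal{I}$, and independently (fresh randomness each round) with probability $\kappa_i$ sends $\Delta_i$ to a secure aggregator and otherwise sends nothing; the aggregator computes $\Delta^{(t)}$, the sum of the received vectors; the server sets $S\leftarrow S\cup\{\arg\max_{e:S\cup\{e\}\in\mathcal{I}}\Delta^{(t)}[e]\}$. Output $S$. *)

theory Defs
  imports "HOL-Probability.Probability"
begin

definition matroid :: "'a set \<Rightarrow> 'a set set \<Rightarrow> bool" where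
  "matroid E \<I> \<longleftrightarrow>
     finite E \<and> \<I> \<subseteq> Pow E \<and> {} \<in> \<I> \<and>
     (\<forall>A B. B \<in> \<I> \<and> A \<subseteq> B \<longrightarrow> A \<in> \<I>) \<and>
     (\<forall>A B. A \<in> \<I> \<and> B \<in> \<I> \<and> card A < card B \<longrightarrow> (\<exists>x\<in>B - A. A \<union> {x} \<in> \<I>))"

definition matroid_rank :: "'a set set \<Rightarrow> nat" where
  "matroid_rank \<I> = Max (card ` \<I>)"

definition uniform_matroid :: "'a set \<Rightarrow> 'a set set \<Rightarrow> bool" where
  "uniform_matroid E \<I> \<longleftrightarrow> (\<exists>k. \<I> = {S. S \<subseteq> E \<and> card S \<le> k})"

definition monotone_set_fun :: "'a set \<Rightarrow> ('a set \<Rightarrow> real) \<Rightarrow> bool" where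
  "monotone_set_fun E g \<longleftrightarrow> (\<forall>A B. A \<subseteq> B \<and> B \<subseteq> E \<longrightarrow> g A \<le> g B)"

definition submodular :: "'a set \<Rightarrow> ('a set \<Rightarrow> real) \<Rightarrow> bool" where
  "submodular E g \<longleftrightarrow>
     (\<forall>A B. A \<subseteq> E \<and> B \<subseteq> E \<longrightarrow> g (A \<union> B) + g (A \<inter> B) \<le> g A + g B)"

definition total_value :: "nat \<Rightarrow> (nat \<Rightarrow> 'a set \<Rightarrow> real) \<Rightarrow> 'a set \<Rightarrow> real" where
  "total_value N f S = (\<Sum>i = 1..N. f i S)"

definition opt_value :: "'a set set \<Rightarrow> ('a set \<Rightarrow> real) \<Rightarrow> real" where
  "opt_value \<I> F = Max (F ` \<I>)"

text \<open>If \<open>F {e} = 0\<close>, then also \<open>f\<^sub>i {e} = 0\<close>, and the ratio \<open>0 / 0\<close> counts as \<open>0\<close>.\<close>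

definition importance :: "'a set \<Rightarrow> nat \<Rightarrow> (nat \<Rightarrow> 'a set \<Rightarrow> real) \<Rightarrow> nat \<Rightarrow> real" where
  "importance E N f i = Max ((\<lambda>e. f i {e} / total_value N f {e}) ` E)"

definition send_prob ::
    "'a set \<Rightarrow> nat \<Rightarrow> (nat \<Rightarrow> 'a set \<Rightarrow> real) \<Rightarrow> real \<Rightarrow> nat \<Rightarrow> real" where
  "send_prob E N f \<kappa> i = min (\<kappa> * importance E N f i) 1"

definition client_vector ::
    "'a set \<Rightarrow> nat \<Rightarrow> (nat \<Rightarrow> 'a set \<Rightarrow> real) \<Rightarrow> real \<Rightarrow> 'a set \<Rightarrow> nat \<Rightarrow> 'a \<Rightarrow> real" where
  "client_vector E N f \<kappa> S i e = (f i (S \<union> {e}) - f i S) / send_prob E N f \<kappa> i"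

definition aggregate ::
    "'a set \<Rightarrow> nat \<Rightarrow> (nat \<Rightarrow> 'a set \<Rightarrow> real) \<Rightarrow> real \<Rightarrow> 'a set \<Rightarrow> nat set \<Rightarrow> 'a \<Rightarrow> real" where
  "aggregate E N f \<kappa> S P e = (\<Sum>i\<in>P. client_vector E N f \<kappa> S i e)"

definition participants ::
    "'a set \<Rightarrow> nat \<Rightarrow> (nat \<Rightarrow> 'a set \<Rightarrow> real) \<Rightarrow> real \<Rightarrow> nat set pmf" where
  "participants E N f \<kappa> =
     map_pmf (\<lambda>b. {i \<in> {1..N}. b i})
       (Pi_pmf {1..N} False (\<lambda>i. bernoulli_pmf (send_prob E N f \<kappa> i)))"

definition feasible :: "'a set \<Rightarrow> 'a set set \<Rightarrow> 'a set \<Rightarrow> 'a set" where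
  "feasible E \<I> S = {e \<in> E. S \<union> {e} \<in> \<I>}"

text \<open>A rule for choosing a maximiser, with arbitrary tie-breaking.\<close>

definition argmax_rule :: "('a set \<Rightarrow> ('a \<Rightarrow> real) \<Rightarrow> 'a) \<Rightarrow> bool" where
  "argmax_rule sel \<longleftrightarrow>
     (\<forall>A D. finite A \<and> A \<noteq> {} \<longrightarrow> is_arg_max D (\<lambda>e. e \<in> A) (sel A D))"

text \<open>
  Joint distribution, after a given number of rounds, of the current set and of the list
  whose entry \<open>t\<close> is the set of clients that sent their vector in round \<open>t\<close>.
\<close>

primrec federated_greedy ::
    "('a set \<Rightarrow> ('a \<Rightarrow> real) \<Rightarrow> 'a) \<Rightarrow> 'a set \<Rightarrow> 'a set set \<Rightarrow> nat \<Rightarrow>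
     (nat \<Rightarrow> 'a set \<Rightarrow> real) \<Rightarrow> real \<Rightarrow> nat \<Rightarrow> ('a set \<times> nat set list) pmf" where
  "federated_greedy sel E \<I> N f \<kappa> 0 = return_pmf ({}, [])"
| "federated_greedy sel E \<I> N f \<kappa> (Suc t) =
     bind_pmf (federated_greedy sel E \<I> N f \<kappa> t) (\<lambda>(S, Ps).
     bind_pmf (participants E N f \<kappa>) (\<lambda>P.
       return_pmf (S \<union> {sel (feasible E \<I> S) (aggregate E N f \<kappa> S P)}, Ps @ [P])))"

text \<open>
  Soft-O: \<open>h = O(g log\<^sup>k g)\<close> for some \<open>k\<close>, uniformly on the parameter set \<open>X\<close>. The shift by \<open>2\<close> keeps the
  logarithm bounded away from \<open>0\<close> for all \<open>g \<ge> 0\<close>.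
\<close>

definition soft_O :: "'p set \<Rightarrow> ('p \<Rightarrow> real) \<Rightarrow> ('p \<Rightarrow> real) \<Rightarrow> bool" where
  "soft_O X h g \<longleftrightarrow>
     (\<exists>C::real. \<exists>k::nat. \<forall>x\<in>X. 0 \<le> h x \<and> h x \<le> C * g x * ln (g x + 2) ^ k)"

definition parameters :: "(nat \<times> nat \<times> real) set" where
  "parameters = {(n, r, \<epsilon>). 0 < \<epsilon> \<and> \<epsilon> < 1}"

end

theory Submission
  imports Defs
begin

text \<open>
  Fix a round with current set \<open>S\<close> and a feasible element \<open>e\<close>. The aggregate at \<open>e\<close> is a sum of
  independent terms with mean \<open>F (S \<union> {e}) - F S \<le> OPT\<close>, and by the choice of the importance
  factors every term that is actually random is at most \<open>F {e} / \<kappa> \<le> OPT / \<kappa>\<close>. A Bernstein bound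
  therefore gives deviation at most \<open>\<epsilon> * OPT / (2 * r)\<close>, except with probability
  \<open>2 * exp (- (\<epsilon>\<^sup>2 * \<kappa> / (16 * r\<^sup>2)))\<close>. Because \<open>r \<le> n\<close>, a rate \<open>\<kappa>\<close> of order \<open>(r * n / \<epsilon>\<^sup>2) * log\<close> makes
  this small enough for a union bound over all rounds and elements. Outside the exceptional event
  every step is a greedy step up to an additive error \<open>\<epsilon> * OPT / r\<close>, so the classical greedy
  guarantees lose at most \<open>\<epsilon> * OPT\<close> in total. The expected number of participants is at most
  \<open>\<kappa>\<close> times the sum of the importance factors, and that sum is at most \<open>n\<close>.
\<close>

section \<open>Concentration\<close>

text \<open>This is what turns a moment generating function into a second-order term. For
  \<open>x = - y < 0\<close>, it reduces to \<open>1 / (1 + y) \<le> 1 - y + y\<^sup>2\<close>,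
  which holds because the product of \<open>1 + y\<close> and \<open>1 - y + y\<^sup>2\<close> is
  \<open>1 + y ^ 3\<close>.\<close>

lemma exp_le_quadratic:
  fixes x :: real
  assumes "\<bar>x\<bar> \<le> 1"
  shows "exp x \<le> 1 + x + x\<^sup>2"
proof (cases "0 \<le> x")
  case True
  then show ?thesis using assms exp_bound[of x] by simp
next
  case False
  define y where "y = - x"
  have y: "y > 0" using False by (simp add: y_def)
  have "exp x = 1 / exp y" by (simp add: y_def exp_minus field_simps)
  also have "\<dots> \<le> 1 / (1 + y)" using y by (intro divide_left_mono) auto
  also have "\<dots> \<le> 1 - y + y\<^sup>2"
  proof -
    have "(1 - y + y\<^sup>2) * (1 + y) = 1 + y ^ 3"
      by (simp add: algebra_simps power2_eq_square power3_eq_cube)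
    then have "1 \<le> (1 - y + y\<^sup>2) * (1 + y)" using y by simp
    then show ?thesis using y by (simp add: pos_divide_le_eq)
  qed
  finally show ?thesis by (simp add: y_def)
qed

text \<open>A term with \<open>p = 1\<close> is deterministic and vanishes after centring, so its
  size \<open>b\<close> may exceed \<open>R\<close>. The sign of \<open>l\<close> is free so that
  one bound serves both tails.\<close>

lemma bernoulli_centered_mgf:
  fixes p b l R :: real
  assumes "0 \<le> p" "p \<le> 1" "0 \<le> b" "p = 1 \<or> b \<le> R" "0 \<le> R" "\<bar>l\<bar> * R \<le> 1"
  shows "measure_pmf.expectation (bernoulli_pmf p) (\<lambda>v. exp (l * ((if v then b else 0) - p * b)))
           \<le> exp (l\<^sup>2 * R * (p * b))"
proof (cases "p = 1")
  case True
  then show ?thesis using assms by simp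
next
  case False
  then have b: "b \<le> R" using assms by auto
  have lb: "\<bar>l * b\<bar> \<le> 1"
    using mult_left_mono[OF b, of "\<bar>l\<bar>"] assms by (simp add: abs_mult)
  have "measure_pmf.expectation (bernoulli_pmf p) (\<lambda>v. exp (l * ((if v then b else 0) - p * b)))
          = exp (l * (b - p * b)) * p + exp (l * (0 - p * b)) * (1 - p)"
    using assms by simp
  also have "\<dots> = exp (- (l * p * b)) * (1 + p * (exp (l * b) - 1))"
  proof -
    have "l * (b - p * b) = - (l * p * b) + l * b" "l * (0 - p * b) = - (l * p * b)"
      by (simp_all add: algebra_simps)
    then show ?thesis by (simp only: exp_add) (simp add: algebra_simps)
  qed
  \<comment> \<open>With \<open>1 + z \<le> exp z\<close>, the linear part of the exponent cancels
    against the centring factor, and only \<open>p * (l * b)\<^sup>2\<close> survives.\<close>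
  also have "\<dots> \<le> exp (- (l * p * b)) * exp (p * (l * b + (l * b)\<^sup>2))"
  proof (intro mult_left_mono)
    have "1 + p * (exp (l * b) - 1) \<le> 1 + p * (l * b + (l * b)\<^sup>2)"
      using exp_le_quadratic[OF lb] assms by (intro add_left_mono mult_left_mono) auto
    also have "\<dots> \<le> exp (p * (l * b + (l * b)\<^sup>2))" by simp
    finally show "1 + p * (exp (l * b) - 1) \<le> exp (p * (l * b + (l * b)\<^sup>2))" .
  qed simp
  also have "\<dots> = exp (l\<^sup>2 * b * (p * b))"
    by (simp add: exp_add[symmetric] algebra_simps power2_eq_square)
  also have "\<dots> \<le> exp (l\<^sup>2 * R * (p * b))"
    using b assms by (auto intro!: mult_right_mono mult_left_mono)
  finally show ?thesis .
qed

text \<open>Markov's inequality for the exponential, which factorises by independence. The variance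
  proxy is \<open>R * M\<close>, with \<open>M\<close> a bound on the mean, so the number of
  summands does not enter.\<close>

lemma bernoulli_sum_exponential_tail:
  fixes p b :: "'i \<Rightarrow> real" and l R M a :: real
  assumes fin: "finite J"
    and p: "\<And>i. i \<in> J \<Longrightarrow> 0 \<le> p i \<and> p i \<le> 1"
    and b: "\<And>i. i \<in> J \<Longrightarrow> 0 \<le> b i \<and> (p i = 1 \<or> b i \<le> R)"
    and R: "0 \<le> R" "\<bar>l\<bar> * R \<le> 1"
    and M: "(\<Sum>i\<in>J. p i * b i) \<le> M"
  shows "measure_pmf.prob (Pi_pmf J False (\<lambda>i. bernoulli_pmf (p i)))
           {v. a \<le> l * ((\<Sum>i\<in>J. if v i then b i else 0) - (\<Sum>i\<in>J. p i * b i))}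
         \<le> exp (l\<^sup>2 * R * M - a)"
proof -
  let ?D = "Pi_pmf J False (\<lambda>i. bernoulli_pmf (p i))"
  let ?g = "\<lambda>i v. exp (l * ((if v then b i else 0) - p i * b i))"
  let ?u = "\<lambda>v. exp (l * ((\<Sum>i\<in>J. if v i then b i else 0) - (\<Sum>i\<in>J. p i * b i)))"
  have u: "?u = (\<lambda>v. \<Prod>i\<in>J. ?g i (v i))"
    by (simp add: exp_sum[OF fin, symmetric] sum_distrib_left sum_subtractf right_diff_distrib)
  have finD: "finite (set_pmf ?D)"
    using fin by (auto simp: set_Pi_pmf intro!: finite_PiE_dflt)
  have "measure_pmf.prob ?D {v \<in> space (measure_pmf ?D). exp a \<le> ?u v}
          \<le> measure_pmf.expectation ?D ?u / exp a"
    by (intro integral_Markov_inequality_measure[where A = "{}"])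
       (auto intro: integrable_measure_pmf_finite[OF finD])
  also have "measure_pmf.expectation ?D ?u = (\<Prod>i\<in>J. measure_pmf.expectation (bernoulli_pmf (p i)) (?g i))"
    unfolding u
    by (intro expectation_prod_Pi_pmf fin) (auto intro!: integrable_measure_pmf_finite)
  also have "\<dots> \<le> (\<Prod>i\<in>J. exp (l\<^sup>2 * R * (p i * b i)))"
    using p b R by (intro prod_mono conjI bernoulli_centered_mgf integral_nonneg_AE) auto
  also have "\<dots> = exp (l\<^sup>2 * R * (\<Sum>i\<in>J. p i * b i))"
    by (simp add: exp_sum[OF fin, symmetric] sum_distrib_left)
  also have "\<dots> \<le> exp (l\<^sup>2 * R * M)"
    using M R by (auto intro!: mult_left_mono)
  finally show ?thesis by (simp add: exp_diff divide_right_mono)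
qed

lemma bernoulli_sum_concentration:
  fixes p b :: "'i \<Rightarrow> real" and \<delta> M k :: real
  assumes fin: "finite J"
    and p: "\<And>i. i \<in> J \<Longrightarrow> 0 \<le> p i \<and> p i \<le> 1"
    and b: "\<And>i. i \<in> J \<Longrightarrow> 0 \<le> b i \<and> (p i = 1 \<or> b i \<le> M / k)"
    and M: "(\<Sum>i\<in>J. p i * b i) \<le> M" "0 < M" and k: "0 < k" and \<delta>: "0 < \<delta>" "\<delta> \<le> 1"
  shows "measure_pmf.prob (Pi_pmf J False (\<lambda>i. bernoulli_pmf (p i)))
           {v. \<delta> * M < \<bar>(\<Sum>i\<in>J. if v i then b i else 0) - (\<Sum>i\<in>J. p i * b i)\<bar>}
         \<le> 2 * exp (- (\<delta>\<^sup>2 * k / 4))"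
proof -
  let ?D = "Pi_pmf J False (\<lambda>i. bernoulli_pmf (p i))"
  let ?X = "\<lambda>v. (\<Sum>i\<in>J. if v i then b i else 0) - (\<Sum>i\<in>J. p i * b i)"
  \<comment> \<open>This value minimises the exponent
    \<open>l\<^sup>2 * M\<^sup>2 / k - l * \<delta> * M\<close>, with minimum
    \<open>- (\<delta>\<^sup>2 * k / 4)\<close>. It makes \<open>l * (M / k) = \<delta> / 2\<close>,
    within the range where the exponential bound applies.\<close>
  define l where "l = \<delta> * k / (2 * M)"
  have l: "l > 0" using M k \<delta> by (simp add: l_def)
  have lR: "l * (M / k) \<le> 1" using M k \<delta> by (simp add: l_def)
  \<comment> \<open>The sign \<open>s\<close> selects the upper or the lower tail.\<close>
  have tail: "measure_pmf.prob ?D {v. l * (\<delta> * M) \<le> s * l * ?X v} \<le> exp (- (\<delta>\<^sup>2 * k / 4))"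
    if s: "s = 1 \<or> s = - 1" for s :: real
  proof -
    have "measure_pmf.prob ?D {v. l * (\<delta> * M) \<le> s * l * ?X v}
            \<le> exp ((s * l)\<^sup>2 * (M / k) * M - l * (\<delta> * M))"
      using M k lR l s
      by (intro bernoulli_sum_exponential_tail fin p b) (auto simp: abs_mult)
    also have "(s * l)\<^sup>2 * (M / k) * M - l * (\<delta> * M) = - (\<delta>\<^sup>2 * k / 4)"
      using M k s by (auto simp: l_def power2_eq_square field_simps)
    finally show ?thesis .
  qed
  have "measure_pmf.prob ?D {v. \<delta> * M < \<bar>?X v\<bar>}
          \<le> measure_pmf.prob ?D ({v. l * (\<delta> * M) \<le> 1 * l * ?X v} \<union> {v. l * (\<delta> * M) \<le> - 1 * l * ?X v})"
  proof (intro measure_pmf.finite_measure_mono subsetI)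
    fix v assume "v \<in> {v. \<delta> * M < \<bar>?X v\<bar>}"
    then have "\<delta> * M \<le> ?X v \<or> \<delta> * M \<le> - ?X v" by auto
    then have "l * (\<delta> * M) \<le> l * ?X v \<or> l * (\<delta> * M) \<le> l * (- ?X v)"
      using l by (simp only: mult_le_cancel_left_pos)
    then show "v \<in> {v. l * (\<delta> * M) \<le> 1 * l * ?X v} \<union> {v. l * (\<delta> * M) \<le> - 1 * l * ?X v}"
      by (simp only: Un_iff mem_Collect_eq mult_1 mult_minus_left mult_minus_right)
  qed simp
  also have "\<dots> \<le> measure_pmf.prob ?D {v. l * (\<delta> * M) \<le> 1 * l * ?X v}
                 + measure_pmf.prob ?D {v. l * (\<delta> * M) \<le> - 1 * l * ?X v}"
    by (intro measure_Un_le) auto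
  also have "\<dots> \<le> 2 * exp (- (\<delta>\<^sup>2 * k / 4))"
    using tail[of 1] tail[of "- 1"] by simp
  finally show ?thesis .
qed

text \<open>One step of a union bound along a random process: either the past is already in the bad
  set \<open>A\<close>, or the next draw fails with conditional probability at most
  \<open>q\<close>.\<close>

lemma prob_bind_pmf_le_add:
  fixes q :: real
  assumes "\<And>x. x \<in> set_pmf D \<Longrightarrow> x \<notin> A \<Longrightarrow> measure_pmf.prob (K x) B \<le> q" and "0 \<le> q"
  shows "measure_pmf.prob (bind_pmf D K) B \<le> measure_pmf.prob D A + q"
proof -
  have "emeasure (bind_pmf D K) B = (\<integral>\<^sup>+x. emeasure (K x) B \<partial>D)" by simp
  also have "\<dots> \<le> (\<integral>\<^sup>+x. indicator A x + ennreal q \<partial>D)"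
  proof (intro nn_integral_mono_AE AE_pmfI)
    fix x assume x: "x \<in> set_pmf D"
    show "emeasure (K x) B \<le> indicator A x + ennreal q"
    proof (cases "x \<in> A")
      case True
      then show ?thesis
        using measure_pmf.emeasure_le_1[of "K x" B] by (auto intro: add_increasing2)
    next
      case False
      then show ?thesis using assms x by (simp add: measure_pmf.emeasure_eq_measure ennreal_leI)
    qed
  qed
  also have "\<dots> = emeasure D A + ennreal q" by (simp add: nn_integral_add)
  finally show ?thesis
    using assms(2) by (simp add: measure_pmf.emeasure_eq_measure flip: ennreal_plus)
qed

section \<open>Monotone submodular functions\<close>

lemma monotone_set_funD:
  assumes "monotone_set_fun E g" "A \<subseteq> B" "B \<subseteq> E"
  shows "g A \<le> g B"
  using assms by (auto simp: monotone_set_fun_def)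

lemma submodularD:
  assumes "submodular E g" "A \<subseteq> E" "B \<subseteq> E"
  shows "g (A \<union> B) + g (A \<inter> B) \<le> g A + g B"
  using assms by (simp add: submodular_def)

text \<open>For \<open>e\<close> outside \<open>T\<close>, this is submodularity of the pair
  \<open>S \<union> {e}\<close> and \<open>T\<close>. For \<open>e\<close> in \<open>T\<close> the
  left side is zero and monotonicity makes the right side nonnegative.\<close>

lemma submodular_diminishing_returns:
  assumes "monotone_set_fun E g" "submodular E g" "S \<subseteq> T" "T \<subseteq> E" "e \<in> E"
  shows "g (T \<union> {e}) - g T \<le> g (S \<union> {e}) - g S"
proof (cases "e \<in> T")
  case True
  moreover have "g S \<le> g (S \<union> {e})" using assms by (intro monotone_set_funD[OF assms(1)]) auto
  ultimately show ?thesis by (simp add: insert_absorb)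
next
  case False
  have "(S \<union> {e}) \<union> T = T \<union> {e}" "(S \<union> {e}) \<inter> T = S" using False assms by auto
  moreover have "g ((S \<union> {e}) \<union> T) + g ((S \<union> {e}) \<inter> T) \<le> g (S \<union> {e}) + g T"
    using assms by (intro submodularD[OF assms(2)]) auto
  ultimately show ?thesis by simp
qed

text \<open>Adding the elements of \<open>A\<close> one at a time, each increment is at most the
  marginal at the smaller set \<open>U\<close>.\<close>

lemma submodular_union_le_sum_marginals:
  assumes "monotone_set_fun E g" "submodular E g" "U \<subseteq> E" "finite A" "A \<subseteq> E"
  shows "g (U \<union> A) - g U \<le> (\<Sum>e\<in>A. g (U \<union> {e}) - g U)"
  using \<open>finite A\<close> \<open>A \<subseteq> E\<close>
proof (induction A rule: finite_induct)
  case (insert x A)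
  have "g ((U \<union> A) \<union> {x}) - g (U \<union> A) \<le> g (U \<union> {x}) - g U"
    using assms insert.prems by (intro submodular_diminishing_returns) auto
  moreover have "U \<union> insert x A = (U \<union> A) \<union> {x}" by auto
  ultimately show ?case using insert by simp
qed simp

lemma monotone_total_value:
  assumes "\<And>i. i \<in> {1..N} \<Longrightarrow> monotone_set_fun E (f i)"
  shows "monotone_set_fun E (total_value N f)"
  unfolding monotone_set_fun_def total_value_def
  by (intro allI impI sum_mono) (use assms in \<open>auto intro: monotone_set_funD\<close>)

lemma submodular_total_value:
  assumes "\<And>i. i \<in> {1..N} \<Longrightarrow> submodular E (f i)"
  shows "submodular E (total_value N f)"
  unfolding submodular_def total_value_def sum.distrib[symmetric]
  by (intro allI impI sum_mono) (use assms in \<open>auto intro: submodularD\<close>)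

section \<open>Matroids\<close>

lemma matroidD:
  assumes "matroid E \<I>"
  shows "finite E" "A \<in> \<I> \<Longrightarrow> A \<subseteq> E" "A \<in> \<I> \<Longrightarrow> finite A" "{} \<in> \<I>"
    "B \<in> \<I> \<Longrightarrow> A \<subseteq> B \<Longrightarrow> A \<in> \<I>"
    "A \<in> \<I> \<Longrightarrow> B \<in> \<I> \<Longrightarrow> card A < card B \<Longrightarrow> \<exists>x\<in>B - A. A \<union> {x} \<in> \<I>"
    "finite \<I>"
proof -
  show "finite E" and sub: "A \<in> \<I> \<Longrightarrow> A \<subseteq> E" for A
    using assms by (auto simp: matroid_def)
  then show "A \<in> \<I> \<Longrightarrow> finite A" by (meson finite_subset)
  show "finite \<I>"
    using \<open>finite E\<close> sub by (meson PowI finite_Pow_iff finite_subset subsetI)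
  show "{} \<in> \<I>" using assms by (auto simp: matroid_def)
  show "B \<in> \<I> \<Longrightarrow> A \<subseteq> B \<Longrightarrow> A \<in> \<I>" using assms unfolding matroid_def by blast
  show "A \<in> \<I> \<Longrightarrow> B \<in> \<I> \<Longrightarrow> card A < card B \<Longrightarrow> \<exists>x\<in>B - A. A \<union> {x} \<in> \<I>"
    using assms unfolding matroid_def by blast
qed

lemma card_le_matroid_rank:
  assumes "matroid E \<I>" "A \<in> \<I>"
  shows "card A \<le> matroid_rank \<I>"
  using assms(2) matroidD(7)[OF assms(1)] by (simp add: matroid_rank_def)

lemma obtain_matroid_basis:
  assumes "matroid E \<I>"
  obtains B where "B \<in> \<I>" "card B = matroid_rank \<I>"
proof -
  have "Max (card ` \<I>) \<in> card ` \<I>"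
    using matroidD(4,7)[OF assms] by (intro Max_in) auto
  then show ?thesis using that by (auto simp: matroid_rank_def)
qed

lemma matroid_rank_le_card:
  assumes "matroid E \<I>"
  shows "matroid_rank \<I> \<le> card E"
proof -
  obtain B where "B \<in> \<I>" "card B = matroid_rank \<I>" by (rule obtain_matroid_basis[OF assms])
  then show ?thesis using card_mono[OF matroidD(1,2)[OF assms]] by metis
qed

text \<open>Guarantees that the maximiser in a round exists. An element already in \<open>S\<close>
  is feasible because adding it changes nothing, so positive rank matters only for empty
  \<open>S\<close>.\<close>

lemma feasible_nonempty:
  assumes "matroid E \<I>" "S \<in> \<I>" "0 < matroid_rank \<I>"
  shows "feasible E \<I> S \<noteq> {}"
proof (cases "S = {}")
  case True
  obtain B where B: "B \<in> \<I>" "card B = matroid_rank \<I>" by (rule obtain_matroid_basis[OF assms(1)])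
  then obtain x where "x \<in> B - S" "S \<union> {x} \<in> \<I>"
    using matroidD(6)[OF assms(1) assms(2) B(1)] assms True by auto
  then show ?thesis using B matroidD(2)[OF assms(1)] by (auto simp: feasible_def)
next
  case False
  then obtain e where "e \<in> S" by auto
  then show ?thesis
    using assms matroidD(2)[OF assms(1), of S] by (auto simp: feasible_def insert_absorb)
qed

lemma opt_value_ge:
  assumes "matroid E \<I>" "A \<in> \<I>"
  shows "F A \<le> opt_value \<I> F"
  using assms(2) matroidD(7)[OF assms(1)] by (simp add: opt_value_def)

lemma obtain_optimum:
  assumes "matroid E \<I>"
  obtains A where "A \<in> \<I>" "F A = opt_value \<I> F"
proof -
  have "Max (F ` \<I>) \<in> F ` \<I>"
    using matroidD(4,7)[OF assms] by (intro Max_in) auto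
  then show ?thesis using that by (auto simp: opt_value_def)
qed

section \<open>Greedy with additive error\<close>

text \<open>A deterministic record of a run, to which all randomness is later reduced. The common
  term \<open>F (\<sigma> s)\<close> is cancelled on both sides, so values stand where greedy
  compares marginal gains.\<close>

definition greedy_chain ::
    "'a set \<Rightarrow> 'a set set \<Rightarrow> ('a set \<Rightarrow> real) \<Rightarrow> real \<Rightarrow> (nat \<Rightarrow> 'a set) \<Rightarrow> nat \<Rightarrow> bool" where
  "greedy_chain E \<I> F \<beta> \<sigma> t \<longleftrightarrow>
     \<sigma> 0 = {} \<and>
     (\<forall>s<t. \<exists>e\<in>feasible E \<I> (\<sigma> s). \<sigma> (Suc s) = \<sigma> s \<union> {e} \<and>
        (\<forall>x\<in>feasible E \<I> (\<sigma> s). F (\<sigma> s \<union> {x}) \<le> F (\<sigma> (Suc s)) + \<beta>))"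

lemma greedy_chain_step:
  assumes "greedy_chain E \<I> F \<beta> \<sigma> t" "s < t"
  obtains e where "e \<in> feasible E \<I> (\<sigma> s)" "\<sigma> (Suc s) = \<sigma> s \<union> {e}"
  using assms unfolding greedy_chain_def by blast

lemma greedy_chain_gain:
  assumes "greedy_chain E \<I> F \<beta> \<sigma> t" "s < t" "x \<in> feasible E \<I> (\<sigma> s)"
  shows "F (\<sigma> s \<union> {x}) \<le> F (\<sigma> (Suc s)) + \<beta>"
  using assms unfolding greedy_chain_def by blast

text \<open>The chain may stall, since \<^const>\<open>feasible\<close> contains the elements already chosen;
  hence only an upper bound on the cardinality.\<close>

lemma greedy_chain_independent:
  assumes "matroid E \<I>" "greedy_chain E \<I> F \<beta> \<sigma> t" "s \<le> t"
  shows "\<sigma> s \<in> \<I> \<and> card (\<sigma> s) \<le> s"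
  using \<open>s \<le> t\<close>
proof (induction s)
  case 0
  then show ?case using assms matroidD(4)[OF assms(1)] by (simp add: greedy_chain_def)
next
  case (Suc s)
  then obtain e where "e \<in> feasible E \<I> (\<sigma> s)" "\<sigma> (Suc s) = \<sigma> s \<union> {e}"
    using greedy_chain_step[OF assms(2), of s] by auto
  moreover have "card (\<sigma> s \<union> {e}) \<le> Suc (card (\<sigma> s))"
    using Suc matroidD(3)[OF assms(1), of "\<sigma> s"] by (auto simp: card_insert_if)
  ultimately show ?case using Suc by (auto simp: feasible_def)
qed

lemma greedy_chain_mono:
  assumes "greedy_chain E \<I> F \<beta> \<sigma> t" "s \<le> u" "u \<le> t"
  shows "\<sigma> s \<subseteq> \<sigma> u"
  using \<open>s \<le> u\<close> \<open>u \<le> t\<close>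
proof (induction u rule: dec_induct)
  case (step v)
  have "\<sigma> v \<subseteq> \<sigma> (Suc v)" using greedy_chain_step[OF assms(1), of v] step.hyps step.prems by (metis Suc_le_lessD Un_upper1)
  then show ?case using step by auto
qed simp

text \<open>Peeling the elements of \<open>A\<close> off backwards: as \<open>\<sigma> m\<close> has fewer than \<open>m + 1\<close> elements, the
  exchange property supplies an element of \<open>A\<close> that was feasible in round \<open>m\<close>.\<close>

lemma sum_marginals_le_greedy:
  assumes mat: "matroid E \<I>" and mono: "monotone_set_fun E F" and sub: "submodular E F"
    and F0: "F {} = 0" and ch: "greedy_chain E \<I> F \<beta> \<sigma> t"
    and A: "A \<in> \<I>" "card A = m" "m \<le> t"
  shows "(\<Sum>e\<in>A. F (\<sigma> t \<union> {e}) - F (\<sigma> t)) \<le> F (\<sigma> m) + real m * \<beta>"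
  using A
proof (induction m arbitrary: A)
  case 0
  then have "A = {}" using matroidD(3)[OF mat] by auto
  then show ?case using F0 ch by (simp add: greedy_chain_def)
next
  case (Suc m)
  have \<sigma>: "\<sigma> m \<in> \<I>" "card (\<sigma> m) \<le> m"
    using greedy_chain_independent[OF mat ch, of m] Suc.prems by auto
  obtain x where x: "x \<in> A - \<sigma> m" "\<sigma> m \<union> {x} \<in> \<I>"
    using matroidD(6)[OF mat \<sigma>(1) Suc.prems(1)] \<sigma>(2) Suc.prems by auto
  have xE: "x \<in> E" using x Suc.prems matroidD(2)[OF mat] by auto
  have finA: "finite A" using Suc.prems matroidD(3)[OF mat] by auto
  \<comment> \<open>The gain of round \<open>m\<close> pays for \<open>x\<close>. Over all elements
    of \<open>A\<close> these gains telescope.\<close>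
  have "F (\<sigma> t \<union> {x}) - F (\<sigma> t) \<le> F (\<sigma> m \<union> {x}) - F (\<sigma> m)"
    using greedy_chain_mono[OF ch, of m t] greedy_chain_independent[OF mat ch, of t]
      matroidD(2)[OF mat, of "\<sigma> t"] Suc.prems xE
    by (intro submodular_diminishing_returns[OF mono sub]) auto
  also have "\<dots> \<le> F (\<sigma> (Suc m)) - F (\<sigma> m) + \<beta>"
  proof -
    have "x \<in> feasible E \<I> (\<sigma> m)" using x xE by (simp add: feasible_def)
    then show ?thesis using greedy_chain_gain[OF ch, of m x] Suc.prems by simp
  qed
  finally have 1: "F (\<sigma> t \<union> {x}) - F (\<sigma> t) \<le> F (\<sigma> (Suc m)) - F (\<sigma> m) + \<beta>" .
  have "A - {x} \<in> \<I>" using matroidD(5)[OF mat Suc.prems(1)] by auto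
  then have 2: "(\<Sum>e\<in>A - {x}. F (\<sigma> t \<union> {e}) - F (\<sigma> t)) \<le> F (\<sigma> m) + real m * \<beta>"
    using Suc.prems x finA by (intro Suc.IH) auto
  have "(\<Sum>e\<in>A. F (\<sigma> t \<union> {e}) - F (\<sigma> t))
          = F (\<sigma> t \<union> {x}) - F (\<sigma> t) + (\<Sum>e\<in>A - {x}. F (\<sigma> t \<union> {e}) - F (\<sigma> t))"
    using x finA by (intro sum.remove) auto
  then show ?case using 1 2 by (simp add: algebra_simps)
qed

text \<open>The value missing from the optimum \<open>A\<close> is at most the sum of the marginals
  of its elements at the final set, and these are charged to the gains of the first
  \<open>card A\<close> rounds. So the final value is counted twice, plus one error per
  round.\<close>

lemma greedy_chain_half_approximation:
  assumes mat: "matroid E \<I>" and mono: "monotone_set_fun E F" and sub: "submodular E F"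
    and F0: "F {} = 0" and ch: "greedy_chain E \<I> F \<beta> \<sigma> r" and r: "matroid_rank \<I> = r"
    and \<beta>: "0 \<le> \<beta>"
  shows "opt_value \<I> F \<le> 2 * F (\<sigma> r) + real r * \<beta>"
proof -
  obtain A where A: "A \<in> \<I>" "F A = opt_value \<I> F" by (rule obtain_optimum[OF mat])
  have cA: "card A \<le> r" using card_le_matroid_rank[OF mat A(1)] r by simp
  have \<sigma>E: "\<sigma> r \<subseteq> E" using greedy_chain_independent[OF mat ch, of r] matroidD(2)[OF mat] by simp
  have AE: "A \<subseteq> E" "finite A" using A matroidD(2,3)[OF mat] by auto
  have "F A \<le> F (\<sigma> r \<union> A)" using mono \<sigma>E AE by (auto simp: monotone_set_fun_def)
  moreover have "F (\<sigma> r \<union> A) - F (\<sigma> r) \<le> (\<Sum>e\<in>A. F (\<sigma> r \<union> {e}) - F (\<sigma> r))"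
    by (intro submodular_union_le_sum_marginals[OF mono sub] \<sigma>E AE)
  moreover have "\<dots> \<le> F (\<sigma> (card A)) + real (card A) * \<beta>"
    by (intro sum_marginals_le_greedy[OF mat mono sub F0 ch A(1) refl cA])
  moreover have "F (\<sigma> (card A)) \<le> F (\<sigma> r)"
    using mono greedy_chain_mono[OF ch cA] \<sigma>E by (auto simp: monotone_set_fun_def)
  moreover have "real (card A) * \<beta> \<le> real r * \<beta>" using cA \<beta> by (intro mult_right_mono) auto
  ultimately show ?thesis using A by simp
qed

text \<open>Before round \<open>r\<close> every element of the optimum is feasible, and the best of
  at most \<open>r\<close> elements closes a \<open>1 / r\<close> fraction of the gap. Each round
  thus contracts the gap by \<open>1 - 1 / r\<close> and adds an error \<beta>; earlier errors only
  shrink.\<close>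

lemma greedy_chain_uniform_gap:
  assumes mat: "matroid E \<I>" and mono: "monotone_set_fun E F" and sub: "submodular E F"
    and F0: "F {} = 0" and ch: "greedy_chain E \<I> F \<beta> \<sigma> r" and r: "matroid_rank \<I> = r"
    and \<beta>: "0 \<le> \<beta>" and uni: "uniform_matroid E \<I>" and s: "s \<le> r"
  shows "opt_value \<I> F - F (\<sigma> s) \<le> (1 - 1 / real r) ^ s * opt_value \<I> F + real s * \<beta>"
  using s
proof (induction s)
  case 0
  then show ?case using F0 ch by (simp add: greedy_chain_def)
next
  case (Suc s)
  let ?O = "opt_value \<I> F"
  have r0: "0 < r" using Suc.prems by simp
  obtain k where k: "\<I> = {S. S \<subseteq> E \<and> card S \<le> k}" using uni by (auto simp: uniform_matroid_def)
  \<comment> \<open>The bound \<open>k\<close> can exceed the rank when it exceeds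
    \<open>card E\<close>; this inequality suffices for feasibility.\<close>
  have "r \<le> k" using obtain_matroid_basis[OF mat] k r by (metis (mono_tags, lifting) mem_Collect_eq)
  obtain A where A: "A \<in> \<I>" "F A = ?O" by (rule obtain_optimum[OF mat])
  have cA: "card A \<le> r" using card_le_matroid_rank[OF mat A(1)] r by simp
  have \<sigma>: "\<sigma> s \<in> \<I>" "card (\<sigma> s) \<le> s" "\<sigma> s \<subseteq> E"
    using greedy_chain_independent[OF mat ch, of s] Suc.prems matroidD(2)[OF mat] by auto
  have \<sigma>': "\<sigma> (Suc s) \<subseteq> E"
    using greedy_chain_independent[OF mat ch, of "Suc s"] Suc.prems matroidD(2)[OF mat] by auto
  have AE: "A \<subseteq> E" "finite A" using A matroidD(2,3)[OF mat] by auto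
  define d where "d = F (\<sigma> (Suc s)) - F (\<sigma> s) + \<beta>"
  have "F (\<sigma> s) \<le> F (\<sigma> (Suc s))"
    using mono greedy_chain_mono[OF ch, of s "Suc s"] Suc.prems \<sigma>' by (auto simp: monotone_set_fun_def)
  then have d0: "0 \<le> d" using \<beta> by (simp add: d_def)
  have gain: "F (\<sigma> s \<union> {x}) - F (\<sigma> s) \<le> d" if "x \<in> A" for x
  proof -
    have "card (\<sigma> s \<union> {x}) \<le> Suc s"
      using \<sigma> matroidD(3)[OF mat, of "\<sigma> s"] by (auto simp: card_insert_if)
    then have "x \<in> feasible E \<I> (\<sigma> s)"
      using that AE \<sigma> Suc.prems \<open>r \<le> k\<close> by (auto simp: feasible_def k)
    then show ?thesis using greedy_chain_gain[OF ch, of s x] Suc.prems by (simp add: d_def)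
  qed
  have "?O \<le> F (\<sigma> s \<union> A)" using monotone_set_funD[OF mono, of A] \<sigma> AE A by simp
  moreover have "F (\<sigma> s \<union> A) - F (\<sigma> s) \<le> (\<Sum>e\<in>A. F (\<sigma> s \<union> {e}) - F (\<sigma> s))"
    by (intro submodular_union_le_sum_marginals[OF mono sub] \<sigma> AE)
  moreover have "\<dots> \<le> real (card A) * d" using sum_bounded_above[of A _ d] gain by auto
  \<comment> \<open>The optimum may have fewer than \<open>r\<close> elements, which is why
    \<open>d\<close> must be nonnegative.\<close>
  moreover have "\<dots> \<le> real r * d" using cA d0 by (intro mult_right_mono) auto
  ultimately have "?O - F (\<sigma> s) \<le> real r * d" by simp
  then have "(?O - F (\<sigma> s)) / real r \<le> d" using r0 by (simp add: field_simps)
  then have "?O - F (\<sigma> (Suc s)) \<le> (1 - 1 / real r) * (?O - F (\<sigma> s)) + \<beta>"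
    by (simp add: d_def algebra_simps diff_divide_distrib)
  also have "\<dots> \<le> (1 - 1 / real r) * ((1 - 1 / real r) ^ s * ?O + real s * \<beta>) + \<beta>"
    using Suc r0 by (intro add_right_mono mult_left_mono) auto
  also have "\<dots> \<le> (1 - 1 / real r) ^ Suc s * ?O + real (Suc s) * \<beta>"
    using \<beta> by (simp add: algebra_simps)
  finally show ?case .
qed

lemma greedy_chain_uniform_approximation:
  assumes mat: "matroid E \<I>" and mono: "monotone_set_fun E F" and sub: "submodular E F"
    and F0: "F {} = 0" and ch: "greedy_chain E \<I> F \<beta> \<sigma> r" and r: "matroid_rank \<I> = r" "0 < r"
    and \<beta>: "0 \<le> \<beta>" and uni: "uniform_matroid E \<I>"
  shows "(1 - 1 / exp 1) * opt_value \<I> F \<le> F (\<sigma> r) + real r * \<beta>"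
proof -
  have "0 \<le> opt_value \<I> F" using opt_value_ge[OF mat matroidD(4)[OF mat], of F] F0 by simp
  moreover have "(1 - 1 / real r) ^ r \<le> 1 / exp 1"
    using exp_ge_one_minus_x_over_n_power_n[of 1 r] r by (simp add: exp_minus inverse_eq_divide)
  ultimately have "(1 - 1 / real r) ^ r * opt_value \<I> F \<le> 1 / exp 1 * opt_value \<I> F"
    by (rule mult_right_mono[rotated])
  then show ?thesis
    using greedy_chain_uniform_gap[OF mat mono sub F0 ch r(1) \<beta> uni order.refl]
    by (simp add: algebra_simps)
qed

section \<open>The federated algorithm\<close>

locale federated_instance =
  fixes E :: "'a set" and \<I> :: "'a set set" and N :: nat and f :: "nat \<Rightarrow> 'a set \<Rightarrow> real"
  assumes matroid: "matroid E \<I>"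
    and nonneg: "\<And>i S. i \<in> {1..N} \<Longrightarrow> S \<subseteq> E \<Longrightarrow> 0 \<le> f i S"
    and empty: "\<And>i. i \<in> {1..N} \<Longrightarrow> f i {} = 0"
    and mono: "\<And>i. i \<in> {1..N} \<Longrightarrow> monotone_set_fun E (f i)"
    and submod: "\<And>i. i \<in> {1..N} \<Longrightarrow> submodular E (f i)"
begin

abbreviation "F \<equiv> total_value N f"
abbreviation "OPT \<equiv> opt_value \<I> F"

lemmas mono_F = monotone_total_value[OF mono]
lemmas submod_F = submodular_total_value[OF submod]

lemma F_empty: "F {} = 0"
  by (simp add: total_value_def empty)

lemma F_nonneg: "S \<subseteq> E \<Longrightarrow> 0 \<le> F S"
  by (auto simp: total_value_def intro!: sum_nonneg nonneg)

lemma OPT_nonneg: "0 \<le> OPT"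
  using opt_value_ge[OF matroid matroidD(4)[OF matroid], of F] F_empty by simp

section \<open>Importance factors and reweighted client vectors\<close>

lemma value_le_importance:
  assumes "i \<in> {1..N}" "e \<in> E"
  shows "f i {e} \<le> importance E N f i * F {e}"
proof -
  \<comment> \<open>Covers \<open>F {e} = 0\<close>, where the quotient is zero by convention and
    carries no information, but \<open>f i {e}\<close> is zero too.\<close>
  have le: "f i {e} \<le> F {e}"
    unfolding total_value_def using assms nonneg by (intro member_le_sum) auto
  have "f i {e} / F {e} \<le> importance E N f i"
    using matroidD(1)[OF matroid] assms by (simp add: importance_def)
  moreover have "0 \<le> F {e}" using F_nonneg assms by simp
  ultimately show ?thesis
    using le by (cases "F {e} = 0") (auto simp: pos_divide_le_eq)
qed

lemma importance_nonneg:
  assumes "i \<in> {1..N}" "E \<noteq> {}"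
  shows "0 \<le> importance E N f i"
proof -
  obtain e where e: "e \<in> E" using assms by auto
  have "0 \<le> f i {e} / F {e}" using nonneg[OF assms(1)] F_nonneg e by simp
  also have "\<dots> \<le> importance E N f i"
    using matroidD(1)[OF matroid] e by (simp add: importance_def)
  finally show ?thesis .
qed

text \<open>The maximum over \<open>e\<close> is at most the sum over \<open>e\<close>; after
  exchanging the sums each element contributes at most one. Nonemptiness keeps \<open>Max\<close>
  away from the empty set.\<close>

lemma sum_importance_le:
  assumes "E \<noteq> {}"
  shows "(\<Sum>i = 1..N. importance E N f i) \<le> real (card E)"
proof -
  have finE: "finite E" by (rule matroidD(1)[OF matroid])
  have "(\<Sum>i = 1..N. importance E N f i) \<le> (\<Sum>i = 1..N. \<Sum>e\<in>E. f i {e} / F {e})"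
  proof (intro sum_mono)
    fix i assume i: "i \<in> {1..N}"
    have "importance E N f i \<in> (\<lambda>e. f i {e} / F {e}) ` E"
      unfolding importance_def using finE assms by (intro Max_in) auto
    then obtain e where e: "e \<in> E" "importance E N f i = f i {e} / F {e}" by auto
    have "f i {e} / F {e} \<le> (\<Sum>e\<in>E. f i {e} / F {e})"
      using finE e i nonneg F_nonneg by (intro member_le_sum) auto
    then show "importance E N f i \<le> (\<Sum>e\<in>E. f i {e} / F {e})" using e by simp
  qed
  also have "\<dots> = (\<Sum>e\<in>E. F {e} / F {e})"
    by (subst sum.swap) (simp only: total_value_def sum_divide_distrib)
  \<comment> \<open>Only an inequality, since elements with \<open>F {e} = 0\<close> contribute
    zero.\<close>
  also have "\<dots> \<le> (\<Sum>e\<in>E. 1)" by (intro sum_mono) simp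
  finally show ?thesis by simp
qed

lemma send_prob_bounds:
  assumes "i \<in> {1..N}" "E \<noteq> {}" "0 \<le> \<kappa>"
  shows "0 \<le> send_prob E N f \<kappa> i" "send_prob E N f \<kappa> i \<le> 1"
  using importance_nonneg[OF assms(1,2)] assms(3) by (auto simp: send_prob_def)

lemma client_marginal:
  assumes "i \<in> {1..N}" "S \<subseteq> E" "e \<in> E"
  shows "0 \<le> f i (S \<union> {e}) - f i S" "f i (S \<union> {e}) - f i S \<le> importance E N f i * F {e}"
proof -
  show "0 \<le> f i (S \<union> {e}) - f i S"
    using monotone_set_funD[OF mono[OF assms(1)], of S "S \<union> {e}"] assms by auto
  have "f i (S \<union> {e}) - f i S \<le> f i ({} \<union> {e}) - f i {}"
    using assms by (intro submodular_diminishing_returns[OF mono submod]) auto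
  then show "f i (S \<union> {e}) - f i S \<le> importance E N f i * F {e}"
    using value_le_importance[OF assms(1,3)] empty[OF assms(1)] by simp
qed

text \<open>Division by the sending probability makes the contribution unbiased. Below probability
  one the factor \<open>w\<close> cancels between the marginal, at most \<open>w * F {e}\<close>,
  and the probability \<open>\<kappa> * w\<close>, so the range is the same for all clients.\<close>

lemma client_vector_bounds:
  assumes i: "i \<in> {1..N}" and S: "S \<subseteq> E" "e \<in> E" and \<kappa>: "0 < \<kappa>"
  shows "0 \<le> client_vector E N f \<kappa> S i e"
    and "send_prob E N f \<kappa> i * client_vector E N f \<kappa> S i e = f i (S \<union> {e}) - f i S"
    and "send_prob E N f \<kappa> i = 1 \<or> client_vector E N f \<kappa> S i e \<le> F {e} / \<kappa>"
proof -
  define w where "w = importance E N f i"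
  define g where "g = f i (S \<union> {e}) - f i S"
  have w: "0 \<le> w" using importance_nonneg[OF i] S by (auto simp: w_def)
  have g: "0 \<le> g" "g \<le> w * F {e}" using client_marginal[OF i S] by (auto simp: w_def g_def)
  have p: "send_prob E N f \<kappa> i = min (\<kappa> * w) 1" by (simp add: send_prob_def w_def)
  have v: "client_vector E N f \<kappa> S i e = g / min (\<kappa> * w) 1"
    by (simp add: client_vector_def g_def p)
  show "0 \<le> client_vector E N f \<kappa> S i e" using g w \<kappa> by (simp add: v)
  \<comment> \<open>If \<open>w = 0\<close>, the client never sends and the quotient is zero, but
    then \<open>g\<close> is zero as well.\<close>
  have "min (\<kappa> * w) 1 * (g / min (\<kappa> * w) 1) = g"
  proof (cases "w = 0")
    case True
    then show ?thesis using g by simp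
  next
    case False
    then have "0 < min (\<kappa> * w) 1" using w \<kappa> by simp
    then show ?thesis by simp
  qed
  then show "send_prob E N f \<kappa> i * client_vector E N f \<kappa> S i e = f i (S \<union> {e}) - f i S"
    by (simp add: p v g_def)
  show "send_prob E N f \<kappa> i = 1 \<or> client_vector E N f \<kappa> S i e \<le> F {e} / \<kappa>"
  proof (cases "w = 0 \<or> \<kappa> * w \<ge> 1")
    case True
    then show ?thesis using F_nonneg[of "{e}"] S \<kappa> by (auto simp: p v)
  next
    case False
    then have "0 < w" "min (\<kappa> * w) 1 = \<kappa> * w" using w by auto
    then show ?thesis using g(2) \<kappa> by (simp add: v field_simps)
  qed
qed

section \<open>Sampling error in one round and over the whole run\<close>

lemma aggregate_participants:
  "aggregate E N f \<kappa> S {i \<in> {1..N}. v i} e =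
     (\<Sum>i\<in>{1..N}. if v i then client_vector E N f \<kappa> S i e else 0)"
  unfolding aggregate_def by (rule sum.inter_filter) simp

lemma aggregate_concentration:
  assumes S: "S \<in> \<I>" and e: "e \<in> feasible E \<I> S" and OPT: "0 < OPT"
    and \<kappa>: "0 < \<kappa>" and \<delta>: "0 < \<delta>" "\<delta> \<le> 1"
  shows "measure_pmf.prob (participants E N f \<kappa>)
           {P. \<delta> * OPT < \<bar>aggregate E N f \<kappa> S P e - (F (S \<union> {e}) - F S)\<bar>}
         \<le> 2 * exp (- (\<delta>\<^sup>2 * \<kappa> / 4))"
proof -
  have SE: "S \<subseteq> E" "e \<in> E" using S e matroidD(2)[OF matroid] by (auto simp: feasible_def)
  then have "E \<noteq> {}" by auto
  \<comment> \<open>Independence of the singleton lets \<open>OPT\<close> bound both the mean of the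
    aggregate and, divided by \<kappa>, the size of its random terms.\<close>
  have "{e} \<in> \<I>" using e matroidD(5)[OF matroid, of "S \<union> {e}"] by (auto simp: feasible_def)
  then have Fe: "F {e} \<le> OPT" by (rule opt_value_ge[OF matroid])
  let ?p = "send_prob E N f \<kappa>" and ?b = "\<lambda>i. client_vector E N f \<kappa> S i e"
  have mean: "(\<Sum>i\<in>{1..N}. ?p i * ?b i) = F (S \<union> {e}) - F S"
    using client_vector_bounds(2)[OF _ SE \<kappa>] by (simp add: total_value_def sum_subtractf)
  have "F (S \<union> {e}) - F S \<le> F ({} \<union> {e}) - F {}"
    using SE by (intro submodular_diminishing_returns[OF mono_F submod_F]) auto
  then have le: "F (S \<union> {e}) - F S \<le> OPT" using Fe F_empty by simp
  have "F {e} / \<kappa> \<le> OPT / \<kappa>" using Fe \<kappa> by (simp add: divide_right_mono)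
  then have b: "0 \<le> ?b i \<and> (?p i = 1 \<or> ?b i \<le> OPT / \<kappa>)" if "i \<in> {1..N}" for i
    using client_vector_bounds(1,3)[OF that SE \<kappa>] by auto
  have "measure_pmf.prob (participants E N f \<kappa>)
           {P. \<delta> * OPT < \<bar>aggregate E N f \<kappa> S P e - (F (S \<union> {e}) - F S)\<bar>} =
        measure_pmf.prob (Pi_pmf {1..N} False (\<lambda>i. bernoulli_pmf (?p i)))
           {v. \<delta> * OPT < \<bar>(\<Sum>i\<in>{1..N}. if v i then ?b i else 0) - (\<Sum>i\<in>{1..N}. ?p i * ?b i)\<bar>}"
    unfolding participants_def mean
    by (simp only: measure_map_pmf vimage_def mem_Collect_eq aggregate_participants)
  also have "\<dots> \<le> 2 * exp (- (\<delta>\<^sup>2 * \<kappa> / 4))"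
    using send_prob_bounds[OF _ \<open>E \<noteq> {}\<close>, of _ \<kappa>] b le mean OPT \<kappa> \<delta>
    by (intro bernoulli_sum_concentration) auto
  finally show ?thesis .
qed

text \<open>A union bound over the feasible elements. The factor two arises because the estimates of
  the chosen element and of its competitor can each be off by \<open>\<delta> * OPT\<close>.\<close>

lemma round_error:
  assumes S: "S \<in> \<I>" and rk: "0 < matroid_rank \<I>" and sel: "argmax_rule sel"
    and \<kappa>: "0 < \<kappa>" and \<delta>: "0 < \<delta>" "\<delta> \<le> 1"
  shows "measure_pmf.prob (participants E N f \<kappa>)
           {P. \<not> (\<forall>x\<in>feasible E \<I> S. F (S \<union> {x}) \<le>
                 F (S \<union> {sel (feasible E \<I> S) (aggregate E N f \<kappa> S P)}) + 2 * \<delta> * OPT)}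
         \<le> real (card E) * (2 * exp (- (\<delta>\<^sup>2 * \<kappa> / 4)))"
proof -
  let ?A = "feasible E \<I> S" and ?D = "participants E N f \<kappa>"
  let ?B = "{P. \<not> (\<forall>x\<in>?A. F (S \<union> {x}) \<le> F (S \<union> {sel ?A (aggregate E N f \<kappa> S P)}) + 2 * \<delta> * OPT)}"
  let ?C = "\<lambda>e. {P. \<delta> * OPT < \<bar>aggregate E N f \<kappa> S P e - (F (S \<union> {e}) - F S)\<bar>}"
  have finE: "finite E" by (rule matroidD(1)[OF matroid])
  have finA: "finite ?A" "card ?A \<le> card E"
    using finE by (auto simp: feasible_def intro: card_mono)
  have arg: "is_arg_max D (\<lambda>e. e \<in> ?A) (sel ?A D)" for D
    using sel finA feasible_nonempty[OF matroid S rk] by (simp add: argmax_rule_def)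
  then have selA: "sel ?A D \<in> ?A" and selmax: "x \<in> ?A \<Longrightarrow> D x \<le> D (sel ?A D)" for D x
    by (auto simp: is_arg_max_def not_less)
  show ?thesis
  proof (cases "OPT = 0")
    case True
    \<comment> \<open>Concentration relative to \<open>OPT\<close> says nothing here, but
      \<open>F\<close> vanishes on all independent sets, so every feasible choice is
      optimal.\<close>
    have "F (S \<union> {x}) \<le> F (S \<union> {sel ?A D})" if "x \<in> ?A" for x D
      using opt_value_ge[OF matroid, of "S \<union> {x}" F] that selA[of D] True
        F_nonneg[of "S \<union> {sel ?A D}"] matroidD(2)[OF matroid, of "S \<union> {sel ?A D}"]
      by (simp add: feasible_def)
    then have "?B = {}" using True by auto
    then show ?thesis by (simp only: measure_empty) simp
  next
    case False
    then have OPT: "0 < OPT" using OPT_nonneg by simp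
    have "?B \<subseteq> (\<Union>e\<in>?A. ?C e)"
    proof (rule ccontr)
      assume "\<not> ?thesis"
      then obtain P x where P: "\<And>e. e \<in> ?A \<Longrightarrow> P \<notin> ?C e" and x: "x \<in> ?A"
        and gt: "F (S \<union> {x}) > F (S \<union> {sel ?A (aggregate E N f \<kappa> S P)}) + 2 * \<delta> * OPT"
        by (auto simp: not_le)
      show False
        using P[OF x] P[OF selA[of "aggregate E N f \<kappa> S P"]] gt selmax[OF x, of "aggregate E N f \<kappa> S P"]
        by (simp add: not_less abs_le_iff)
    qed
    then have "measure_pmf.prob ?D ?B \<le> measure_pmf.prob ?D (\<Union>e\<in>?A. ?C e)"
      by (intro measure_pmf.finite_measure_mono) auto
    also have "\<dots> \<le> (\<Sum>e\<in>?A. measure_pmf.prob ?D (?C e))"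
      by (intro measure_pmf.finite_measure_subadditive_finite finA) auto
    also have "\<dots> \<le> (\<Sum>e\<in>?A. 2 * exp (- (\<delta>\<^sup>2 * \<kappa> / 4)))"
      by (intro sum_mono aggregate_concentration S OPT \<kappa> \<delta>)
    also have "\<dots> \<le> real (card E) * (2 * exp (- (\<delta>\<^sup>2 * \<kappa> / 4)))"
      using finA by (simp add: mult_right_mono)
    finally show ?thesis .
  qed
qed

text \<open>Fresh sampling lets the one-round bound apply given any past, so the failure
  probabilities add up. The state remembers only the current set, hence the good event asks for some
  chain ending there.\<close>

lemma run_greedy_chain:
  assumes rk: "0 < matroid_rank \<I>" and sel: "argmax_rule sel"
    and \<kappa>: "0 < \<kappa>" and \<delta>: "0 < \<delta>" "\<delta> \<le> 1"
  shows "measure_pmf.prob (federated_greedy sel E \<I> N f \<kappa> t)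
           {(S, Ps). \<not> (\<exists>\<sigma>. greedy_chain E \<I> F (2 * \<delta> * OPT) \<sigma> t \<and> \<sigma> t = S)}
         \<le> real t * (real (card E) * (2 * exp (- (\<delta>\<^sup>2 * \<kappa> / 4))))"
proof (induction t)
  case 0
  have "\<exists>\<sigma>. greedy_chain E \<I> F (2 * \<delta> * OPT) \<sigma> 0 \<and> \<sigma> 0 = {}"
    by (intro exI[of _ "\<lambda>_. {}"]) (simp add: greedy_chain_def)
  then show ?case by simp
next
  case (Suc t)
  let ?q = "real (card E) * (2 * exp (- (\<delta>\<^sup>2 * \<kappa> / 4)))"
  let ?\<beta> = "2 * \<delta> * OPT"
  let ?bad = "\<lambda>t. {(S, Ps :: nat set list). \<not> (\<exists>\<sigma>. greedy_chain E \<I> F ?\<beta> \<sigma> t \<and> \<sigma> t = S)}"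
  let ?next = "\<lambda>S P. S \<union> {sel (feasible E \<I> S) (aggregate E N f \<kappa> S P)}"
  have step: "measure_pmf.prob (bind_pmf (participants E N f \<kappa>) (\<lambda>P. return_pmf (?next S P, Ps @ [P])))
          (?bad (Suc t)) \<le> ?q" if good: "(S, Ps) \<notin> ?bad t" for S Ps
  proof -
    obtain \<sigma> where \<sigma>: "greedy_chain E \<I> F ?\<beta> \<sigma> t" "\<sigma> t = S" using good by auto
    have S: "S \<in> \<I>" using greedy_chain_independent[OF matroid \<sigma>(1), of t] \<sigma>(2) by simp
    have selA: "sel (feasible E \<I> S) D \<in> feasible E \<I> S" for D
    proof -
      have "finite (feasible E \<I> S)" using matroidD(1)[OF matroid] by (simp add: feasible_def)
      then show ?thesis
        using sel feasible_nonempty[OF matroid S rk] unfolding argmax_rule_def is_arg_max_def by blast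
    qed
    \<comment> \<open>A good round extends the old chain by the new set.\<close>
    have chain: "\<exists>\<sigma>. greedy_chain E \<I> F ?\<beta> \<sigma> (Suc t) \<and> \<sigma> (Suc t) = ?next S P"
      if "\<forall>x\<in>feasible E \<I> S. F (S \<union> {x}) \<le> F (?next S P) + ?\<beta>" for P
    proof (intro exI[of _ "\<sigma>(Suc t := ?next S P)"] conjI)
      show "greedy_chain E \<I> F ?\<beta> (\<sigma>(Suc t := ?next S P)) (Suc t)"
        unfolding greedy_chain_def
      proof (intro conjI allI impI)
        show "(\<sigma>(Suc t := ?next S P)) 0 = {}" using \<sigma> by (simp add: greedy_chain_def)
        fix s assume "s < Suc t"
        then consider "s < t" | "s = t" by linarith
        then show "\<exists>e\<in>feasible E \<I> ((\<sigma>(Suc t := ?next S P)) s).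
            (\<sigma>(Suc t := ?next S P)) (Suc s) = (\<sigma>(Suc t := ?next S P)) s \<union> {e} \<and>
            (\<forall>x\<in>feasible E \<I> ((\<sigma>(Suc t := ?next S P)) s).
               F ((\<sigma>(Suc t := ?next S P)) s \<union> {x}) \<le> F ((\<sigma>(Suc t := ?next S P)) (Suc s)) + ?\<beta>)"
        proof cases
          case 1
          then show ?thesis using \<sigma>(1) unfolding greedy_chain_def by simp
        next
          case 2
          then show ?thesis
            using selA[of "aggregate E N f \<kappa> S P"] that \<sigma>(2)
            by (intro bexI[of _ "sel (feasible E \<I> S) (aggregate E N f \<kappa> S P)"]) simp_all
        qed
      qed
    qed simp
    have "bind_pmf (participants E N f \<kappa>) (\<lambda>P. return_pmf (?next S P, Ps @ [P]))
            = map_pmf (\<lambda>P. (?next S P, Ps @ [P])) (participants E N f \<kappa>)"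
      by (simp add: map_pmf_def)
    then have "measure_pmf.prob (bind_pmf (participants E N f \<kappa>) (\<lambda>P. return_pmf (?next S P, Ps @ [P])))
            (?bad (Suc t))
          = measure_pmf.prob (participants E N f \<kappa>) ((\<lambda>P. (?next S P, Ps @ [P])) -` ?bad (Suc t))"
      by (simp only: measure_map_pmf)
    also have "\<dots> \<le> measure_pmf.prob (participants E N f \<kappa>)
            {P. \<not> (\<forall>x\<in>feasible E \<I> S. F (S \<union> {x}) \<le> F (?next S P) + ?\<beta>)}"
    proof (intro measure_pmf.finite_measure_mono subsetI)
      fix P assume "P \<in> (\<lambda>P. (?next S P, Ps @ [P])) -` ?bad (Suc t)"
      then have "\<not> (\<exists>\<sigma>. greedy_chain E \<I> F ?\<beta> \<sigma> (Suc t) \<and> \<sigma> (Suc t) = ?next S P)"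
        by (simp only: vimage_eq mem_Collect_eq prod.case not_False_eq_True)
      then show "P \<in> {P. \<not> (\<forall>x\<in>feasible E \<I> S. F (S \<union> {x}) \<le> F (?next S P) + ?\<beta>)}"
        using chain by blast
    qed simp
    also have "\<dots> \<le> ?q" by (rule round_error[OF S rk sel \<kappa> \<delta>])
    finally show ?thesis .
  qed
  have "measure_pmf.prob (federated_greedy sel E \<I> N f \<kappa> (Suc t)) (?bad (Suc t))
          \<le> measure_pmf.prob (federated_greedy sel E \<I> N f \<kappa> t) (?bad t) + ?q"
    unfolding federated_greedy.simps
  proof (rule prob_bind_pmf_le_add)
    fix x :: "'a set \<times> nat set list"
    assume "x \<notin> ?bad t"
    then show "measure_pmf.prob (case x of (S, Ps) \<Rightarrow>
        bind_pmf (participants E N f \<kappa>) (\<lambda>P. return_pmf (?next S P, Ps @ [P]))) (?bad (Suc t)) \<le> ?q"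
      using step by (cases x) (simp only: prod.case)
  qed simp
  also have "\<dots> \<le> real t * ?q + ?q" using Suc by simp
  finally show ?case by (simp add: algebra_simps)
qed

text \<open>The bridge from the random run to the deterministic analysis; both approximation ratios
  pass through it.\<close>

lemma prob_guarantee_of_greedy_chain:
  assumes rk: "0 < matroid_rank \<I>" and sel: "argmax_rule sel"
    and \<kappa>: "0 < \<kappa>" and \<delta>: "0 < \<delta>" "\<delta> \<le> 1"
    and q: "real t * (real (card E) * (2 * exp (- (\<delta>\<^sup>2 * \<kappa> / 4)))) \<le> q"
    and c: "\<And>\<sigma>. greedy_chain E \<I> F (2 * \<delta> * OPT) \<sigma> t \<Longrightarrow> c * OPT \<le> F (\<sigma> t)"
  shows "1 - q \<le> measure_pmf.prob (federated_greedy sel E \<I> N f \<kappa> t)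
           {(S, Ps). S \<in> \<I> \<and> c * OPT \<le> F S}"
proof -
  let ?D = "federated_greedy sel E \<I> N f \<kappa> t"
  let ?bad = "{(S, Ps :: nat set list). \<not> (\<exists>\<sigma>. greedy_chain E \<I> F (2 * \<delta> * OPT) \<sigma> t \<and> \<sigma> t = S)}"
  have "1 - q \<le> 1 - measure_pmf.prob ?D ?bad"
    using run_greedy_chain[OF rk sel \<kappa> \<delta>, of t] q by linarith
  also have "\<dots> = measure_pmf.prob ?D (- ?bad)"
    using measure_pmf.prob_compl[of ?bad ?D] by (simp add: Compl_eq_Diff_UNIV)
  also have "\<dots> \<le> measure_pmf.prob ?D {(S, Ps). S \<in> \<I> \<and> c * OPT \<le> F S}"
    using greedy_chain_independent[OF matroid _ order.refl] c
    by (intro measure_pmf.finite_measure_mono subsetI) auto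
  finally show ?thesis .
qed

section \<open>Expected number of participants\<close>

lemma length_run: "(S, Ps) \<in> set_pmf (federated_greedy sel E \<I> N f \<kappa> t) \<Longrightarrow> length Ps = t"
  by (induction t arbitrary: S Ps) (auto split: prod.splits)

text \<open>Later rounds only append to the list, and the sampling law of a round does not depend on
  the current set.\<close>

lemma run_participants:
  assumes "s < t"
  shows "map_pmf (\<lambda>(S, Ps). Ps ! s) (federated_greedy sel E \<I> N f \<kappa> t) = participants E N f \<kappa>"
  using assms
proof (induction t)
  case (Suc t)
  let ?next = "\<lambda>S P. S \<union> {sel (feasible E \<I> S) (aggregate E N f \<kappa> S P)}"
  have "map_pmf (\<lambda>(S, Ps). Ps ! s) (federated_greedy sel E \<I> N f \<kappa> (Suc t)) =
      bind_pmf (federated_greedy sel E \<I> N f \<kappa> t) (\<lambda>(S, Ps).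
        map_pmf (\<lambda>P. (Ps @ [P]) ! s) (participants E N f \<kappa>))"
    by (simp add: map_bind_pmf case_prod_unfold map_pmf_def bind_assoc_pmf bind_return_pmf)
  \<comment> \<open>The list has length \<open>t\<close>, so index \<open>t\<close> is the new draw
    and smaller indices read the old list.\<close>
  also have "\<dots> = bind_pmf (federated_greedy sel E \<I> N f \<kappa> t) (\<lambda>(S, Ps).
        if s = t then participants E N f \<kappa> else return_pmf (Ps ! s))"
    using Suc.prems length_run
    by (intro bind_pmf_cong refl) (force simp: nth_append map_pmf_const)
  also have "\<dots> = participants E N f \<kappa>"
  proof (cases "s = t")
    case True
    then show ?thesis by (simp add: case_prod_unfold)
  next
    case False
    then show ?thesis using Suc by (simp add: map_pmf_def case_prod_unfold)
  qed
  finally show ?case .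
qed simp

lemma expected_card_participants:
  assumes "E \<noteq> {}" "0 \<le> \<kappa>"
  shows "measure_pmf.expectation (participants E N f \<kappa>) (\<lambda>P. real (card P)) \<le> real (card E) * \<kappa>"
proof -
  let ?D = "Pi_pmf {1..N} False (\<lambda>i. bernoulli_pmf (send_prob E N f \<kappa> i))"
  have fin: "finite (set_pmf ?D)"
    by (auto simp: set_Pi_pmf intro!: finite_PiE_dflt)
  have "measure_pmf.expectation (participants E N f \<kappa>) (\<lambda>P. real (card P)) =
      measure_pmf.expectation ?D (\<lambda>v. \<Sum>i = 1..N. of_bool (v i))"
    unfolding participants_def
    by (auto simp: sum.If_cases of_bool_def Int_def intro!: Bochner_Integration.integral_cong)
  also have "\<dots> = (\<Sum>i = 1..N. measure_pmf.expectation ?D (\<lambda>v. of_bool (v i)))"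
    by (intro Bochner_Integration.integral_sum integrable_measure_pmf_finite fin)
  also have "\<dots> = (\<Sum>i = 1..N. send_prob E N f \<kappa> i)"
  proof (intro sum.cong refl)
    fix i assume i: "i \<in> {1..N}"
    have "measure_pmf.expectation ?D (\<lambda>v. of_bool (v i) :: real)
        = measure_pmf.expectation (map_pmf (\<lambda>v. v i) ?D) of_bool"
      by simp
    also have "map_pmf (\<lambda>v. v i) ?D = bernoulli_pmf (send_prob E N f \<kappa> i)"
      using i by (subst Pi_pmf_component) auto
    also have "measure_pmf.expectation \<dots> of_bool = send_prob E N f \<kappa> i"
      using send_prob_bounds[OF i assms] by simp
    finally show "measure_pmf.expectation ?D (\<lambda>v. of_bool (v i)) = send_prob E N f \<kappa> i" .
  qed
  also have "\<dots> \<le> (\<Sum>i = 1..N. \<kappa> * importance E N f i)"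
    by (intro sum_mono) (simp add: send_prob_def)
  also have "\<dots> \<le> real (card E) * \<kappa>"
    using mult_left_mono[OF sum_importance_le[OF assms(1)] assms(2)]
    by (simp add: sum_distrib_left mult.commute)
  finally show ?thesis .
qed

lemma expected_participants_in_round:
  assumes "E \<noteq> {}" "0 \<le> \<kappa>" "s < t"
  shows "measure_pmf.expectation (federated_greedy sel E \<I> N f \<kappa> t) (\<lambda>(S, Ps). real (card (Ps ! s)))
           \<le> real (card E) * \<kappa>"
proof -
  have "measure_pmf.expectation (federated_greedy sel E \<I> N f \<kappa> t) (\<lambda>(S, Ps). real (card (Ps ! s)))
      = measure_pmf.expectation (map_pmf (\<lambda>(S, Ps). Ps ! s) (federated_greedy sel E \<I> N f \<kappa> t))
          (\<lambda>P. real (card P))"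
    by (simp add: case_prod_unfold)
  then show ?thesis
    using expected_card_participants[OF assms(1,2)] by (simp add: run_participants[OF assms(3)])
qed

end

section \<open>The sampling rate\<close>

text \<open>The constant 64 is chosen so that the failure exponent for
  \<open>\<delta> = \<epsilon> / (2 * r)\<close> becomes \<open>4 * (n / r)\<close> times the
  logarithm; the shift by two agrees with \<open>soft_O\<close>.\<close>

definition sampling_rate :: "nat \<times> nat \<times> real \<Rightarrow> real" where
  "sampling_rate = (\<lambda>(n, r, \<epsilon>).
     64 * (real r * real n / \<epsilon>\<^sup>2) * ln (real r * real n / \<epsilon>\<^sup>2 + 2))"

lemma soft_O_sampling_rate:
  "soft_O parameters sampling_rate (\<lambda>(n, r, \<epsilon>). real r * real n / \<epsilon>\<^sup>2)"
  unfolding soft_O_def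
  by (intro exI[of _ 64] exI[of _ 1]) (auto simp: sampling_rate_def)

text \<open>The extra factor \<open>n\<close> only enlarges the argument of the logarithm, so
  monotonicity of \<open>ln\<close> suffices.\<close>

lemma soft_O_expected_participants:
  "soft_O parameters (\<lambda>(n, r, \<epsilon>). real n * sampling_rate (n, r, \<epsilon>))
     (\<lambda>(n, r, \<epsilon>). real r * (real n)\<^sup>2 / \<epsilon>\<^sup>2)"
proof -
  have "real n * sampling_rate (n, r, \<epsilon>)
      \<le> 64 * (real r * (real n)\<^sup>2 / \<epsilon>\<^sup>2) * ln (real r * (real n)\<^sup>2 / \<epsilon>\<^sup>2 + 2)" for n r :: nat and \<epsilon> :: real
  proof -
    have "real n * 1 \<le> real n * real n" by (cases n) (auto intro: mult_left_mono)
    then have "real r * real n / \<epsilon>\<^sup>2 \<le> real r * (real n)\<^sup>2 / \<epsilon>\<^sup>2"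
      by (intro divide_right_mono mult_left_mono) (auto simp: power2_eq_square)
    moreover have "0 \<le> real r * real n / \<epsilon>\<^sup>2" by simp
    ultimately have "ln (real r * real n / \<epsilon>\<^sup>2 + 2) \<le> ln (real r * (real n)\<^sup>2 / \<epsilon>\<^sup>2 + 2)"
      by (intro ln_mono) linarith+
    then have "64 * (real r * (real n)\<^sup>2 / \<epsilon>\<^sup>2) * ln (real r * real n / \<epsilon>\<^sup>2 + 2)
        \<le> 64 * (real r * (real n)\<^sup>2 / \<epsilon>\<^sup>2) * ln (real r * (real n)\<^sup>2 / \<epsilon>\<^sup>2 + 2)"
      by (intro mult_left_mono) auto
    then show ?thesis by (simp add: sampling_rate_def power2_eq_square mult_ac)
  qed
  then show ?thesis
    unfolding soft_O_def
    by (intro exI[of _ 64] exI[of _ 1]) (auto simp: sampling_rate_def)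
qed

text \<open>From \<open>r \<le> n\<close> and \<open>n \<le> g\<close>, the exponent is at least
  \<open>4 * ln (n + 2)\<close>. The total failure probability is then at most
  \<open>2 * n\<^sup>2 / (n + 2) ^ 4\<close>, which is below \<open>1 / n\<close>.\<close>

lemma sampling_rate_union_bound:
  assumes r: "1 \<le> r" "r \<le> n" and \<epsilon>: "0 < \<epsilon>" "\<epsilon> < 1"
  shows "real r * (real n * (2 * exp (- ((\<epsilon> / (2 * real r))\<^sup>2 * sampling_rate (n, r, \<epsilon>) / 4)))) \<le> 1 / real n"
proof -
  define g where "g = real r * real n / \<epsilon>\<^sup>2"
  have n: "1 \<le> real n" using r by simp
  have "\<epsilon>\<^sup>2 \<le> 1" using \<epsilon> by (simp add: power_le_one)
  moreover have "real n \<le> real r * real n" using r by simp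
  ultimately have "real n * \<epsilon>\<^sup>2 \<le> real r * real n"
    using mult_left_mono[of "\<epsilon>\<^sup>2" 1 "real n"] by linarith
  then have gn: "real n \<le> g" using \<epsilon> by (simp add: g_def pos_le_divide_eq)
  have "(\<epsilon> / (2 * real r))\<^sup>2 * sampling_rate (n, r, \<epsilon>) / 4 = 4 * (real n / real r) * ln (g + 2)"
    using r \<epsilon> by (simp add: sampling_rate_def g_def power2_eq_square field_simps)
  moreover have "4 * 1 * ln (real n + 2) \<le> 4 * (real n / real r) * ln (g + 2)"
    using r gn n by (intro mult_mono) (auto intro!: ln_ge_zero)
  ultimately have "exp (- ((\<epsilon> / (2 * real r))\<^sup>2 * sampling_rate (n, r, \<epsilon>) / 4)) \<le> exp (- (4 * ln (real n + 2)))"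
    by simp
  also have "\<dots> = 1 / (real n + 2) ^ 4"
  proof -
    have "exp (4 * ln (real n + 2)) = (real n + 2) ^ 4"
      using exp_of_nat_mult[of 4 "ln (real n + 2)"] by simp
    then show ?thesis by (simp add: exp_minus inverse_eq_divide)
  qed
  finally have "real r * (real n * (2 * exp (- ((\<epsilon> / (2 * real r))\<^sup>2 * sampling_rate (n, r, \<epsilon>) / 4))))
      \<le> real n * (real n * (2 * (1 / (real n + 2) ^ 4)))"
    using r by (intro mult_mono) auto
  also have "\<dots> \<le> 1 / real n"
  proof -
    have "2 * real n ^ 3 \<le> (real n + 2) * (real n + 2) ^ 3"
      by (intro mult_mono power_mono) auto
    also have "\<dots> = (real n + 2) ^ 4" by (simp add: eval_nat_numeral)
    finally show ?thesis using n by (simp add: field_simps power3_eq_cube)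
  qed
  finally show ?thesis .
qed

theorem theorem5p1:
  "\<exists>(\<kappa> :: nat \<times> nat \<times> real \<Rightarrow> real) (\<rho> :: nat \<times> nat \<times> real \<Rightarrow> real).
     soft_O parameters \<kappa> (\<lambda>(n, r, \<epsilon>). real r * real n / \<epsilon>\<^sup>2) \<and>
     soft_O parameters \<rho> (\<lambda>(n, r, \<epsilon>). real r * (real n)\<^sup>2 / \<epsilon>\<^sup>2) \<and>
     (\<forall>(E :: 'a set) (\<I> :: 'a set set) (N :: nat) (f :: nat \<Rightarrow> 'a set \<Rightarrow> real)
        (sel :: 'a set \<Rightarrow> ('a \<Rightarrow> real) \<Rightarrow> 'a) (n :: nat) (r :: nat) (\<epsilon> :: real).
        finite E \<and> card E = n \<and>
        (\<forall>i\<in>{1..N}. (\<forall>S. S \<subseteq> E \<longrightarrow> 0 \<le> f i S) \<and> f i {} = 0 \<and>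
                     monotone_set_fun E (f i) \<and> submodular E (f i)) \<and>
        matroid E \<I> \<and> matroid_rank \<I> = r \<and>
        argmax_rule sel \<and> 0 < \<epsilon> \<and> \<epsilon> < 1 \<longrightarrow>
        (let F = total_value N f;
             OPT = opt_value \<I> F;
             run = federated_greedy sel E \<I> N f (\<kappa> (n, r, \<epsilon>)) r
         in measure_pmf.prob run {(S, Ps). S \<in> \<I> \<and> (1 / 2 - \<epsilon>) * OPT \<le> F S}
              \<ge> 1 - 1 / real n \<and>
            (uniform_matroid E \<I> \<longrightarrow>
              measure_pmf.prob run {(S, Ps). S \<in> \<I> \<and> (1 - 1 / exp 1 - \<epsilon>) * OPT \<le> F S}
                \<ge> 1 - 1 / real n) \<and>
            (\<forall>t<r. measure_pmf.expectation run (\<lambda>(S, Ps). real (card (Ps ! t)))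
                \<le> \<rho> (n, r, \<epsilon>))))"
\<comment> \<open>The participation bound is \<open>n\<close> times the rate because the importance
  factors sum to at most \<open>n\<close>.\<close>
proof (rule exI[of _ sampling_rate], rule exI[of _ "\<lambda>(n, r, \<epsilon>). real n * sampling_rate (n, r, \<epsilon>)"],
    intro conjI soft_O_sampling_rate soft_O_expected_participants allI impI)
  fix E :: "'a set" and \<I> :: "'a set set" and N :: nat and f :: "nat \<Rightarrow> 'a set \<Rightarrow> real"
    and sel :: "'a set \<Rightarrow> ('a \<Rightarrow> real) \<Rightarrow> 'a" and n r :: nat and \<epsilon> :: real
  assume asm: "finite E \<and> card E = n \<and>
        (\<forall>i\<in>{1..N}. (\<forall>S. S \<subseteq> E \<longrightarrow> 0 \<le> f i S) \<and> f i {} = 0 \<and>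
                     monotone_set_fun E (f i) \<and> submodular E (f i)) \<and>
        matroid E \<I> \<and> matroid_rank \<I> = r \<and>
        argmax_rule sel \<and> 0 < \<epsilon> \<and> \<epsilon> < 1"
  then have n: "card E = n" and r: "matroid_rank \<I> = r" and sel: "argmax_rule sel"
    and \<epsilon>: "0 < \<epsilon>" "\<epsilon> < 1" by auto
  interpret federated_instance E \<I> N f
    using asm by unfold_locales auto
  define \<kappa> where "\<kappa> = sampling_rate (n, r, \<epsilon>)"
  let ?run = "federated_greedy sel E \<I> N f \<kappa> r"
  have goal: "1 - 1 / real n \<le> measure_pmf.prob ?run {(S, Ps). S \<in> \<I> \<and> (1 / 2 - \<epsilon>) * OPT \<le> F S} \<and>
      (uniform_matroid E \<I> \<longrightarrow>
        1 - 1 / real n \<le> measure_pmf.prob ?run {(S, Ps). S \<in> \<I> \<and> (1 - 1 / exp 1 - \<epsilon>) * OPT \<le> F S}) \<and>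
      (\<forall>t<r. measure_pmf.expectation ?run (\<lambda>(S, Ps). real (card (Ps ! t))) \<le> real n * \<kappa>)"
  proof (cases "r = 0")
    case True
    \<comment> \<open>In rank zero the run surely returns the empty set, which is optimal. This
      includes \<open>n = 0\<close>, where \<open>1 / real n\<close> is zero and the required
      probability is one.\<close>
    obtain A where A: "A \<in> \<I>" "F A = OPT" by (rule obtain_optimum[OF matroid])
    have "card A = 0" using card_le_matroid_rank[OF matroid A(1)] r True by simp
    then have "A = {}" using matroidD(3)[OF matroid A(1)] by simp
    then have "OPT = 0" using A F_empty by simp
    then show ?thesis using True F_empty A \<open>A = {}\<close> by simp
  next
    case False
    then have r0: "0 < matroid_rank \<I>" and r1: "1 \<le> r" "0 < r" using r by auto
    have rn: "r \<le> n" using matroid_rank_le_card[OF matroid] r n by simp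
    have E: "E \<noteq> {}" using rn r1 n by auto
    have g: "0 < real r * real n / \<epsilon>\<^sup>2" using r1 rn \<epsilon> by simp
    have "0 < ln (real r * real n / \<epsilon>\<^sup>2 + 2)" using g by (intro ln_gt_zero) linarith
    then have \<kappa>: "0 < \<kappa>" using r1 rn \<epsilon> by (simp add: \<kappa>_def sampling_rate_def)
    \<comment> \<open>Each round loses \<open>2 * \<delta> * OPT = \<epsilon> * OPT / r\<close>,
      hence \<open>r\<close> rounds lose \<open>\<epsilon> * OPT\<close>.\<close>
    define \<delta> where "\<delta> = \<epsilon> / (2 * real r)"
    have \<delta>: "0 < \<delta>" "\<delta> \<le> 1" using \<epsilon> r1 by (auto simp: \<delta>_def)
    have q: "real r * (real (card E) * (2 * exp (- (\<delta>\<^sup>2 * \<kappa> / 4)))) \<le> 1 / real n"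
      using sampling_rate_union_bound[OF r1(1) rn \<epsilon>] by (simp add: \<delta>_def \<kappa>_def n)
    have \<beta>: "0 \<le> 2 * \<delta> * OPT" "real r * (2 * \<delta> * OPT) = \<epsilon> * OPT"
      using \<epsilon> OPT_nonneg r1 by (auto simp: \<delta>_def)
    have \<epsilon>OPT: "0 \<le> \<epsilon> * OPT" using \<epsilon> OPT_nonneg by simp
    show ?thesis
    proof (intro conjI impI allI)
      show "1 - 1 / real n \<le> measure_pmf.prob ?run {(S, Ps). S \<in> \<I> \<and> (1 / 2 - \<epsilon>) * OPT \<le> F S}"
      proof (rule prob_guarantee_of_greedy_chain[OF r0 sel \<kappa> \<delta> q])
        fix \<sigma> assume "greedy_chain E \<I> F (2 * \<delta> * OPT) \<sigma> r"
        then have "OPT \<le> 2 * F (\<sigma> r) + \<epsilon> * OPT"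
          using greedy_chain_half_approximation[OF matroid mono_F submod_F F_empty _ r \<beta>(1)] \<beta>(2) by simp
        \<comment> \<open>Halving leaves a loss of only \<open>\<epsilon> / 2 * OPT\<close>, so
          there is slack.\<close>
        then show "(1 / 2 - \<epsilon>) * OPT \<le> F (\<sigma> r)" using \<epsilon>OPT by (simp add: algebra_simps)
      qed
    next
      assume uni: "uniform_matroid E \<I>"
      show "1 - 1 / real n \<le> measure_pmf.prob ?run {(S, Ps). S \<in> \<I> \<and> (1 - 1 / exp 1 - \<epsilon>) * OPT \<le> F S}"
      proof (rule prob_guarantee_of_greedy_chain[OF r0 sel \<kappa> \<delta> q])
        fix \<sigma> assume "greedy_chain E \<I> F (2 * \<delta> * OPT) \<sigma> r"
        then have "(1 - 1 / exp 1) * OPT \<le> F (\<sigma> r) + \<epsilon> * OPT"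
          using greedy_chain_uniform_approximation[OF matroid mono_F submod_F F_empty _ r r1(2) \<beta>(1) uni] \<beta>(2)
          by simp
        then show "(1 - 1 / exp 1 - \<epsilon>) * OPT \<le> F (\<sigma> r)" by (simp add: left_diff_distrib)
      qed
    next
      fix t assume "t < r"
      then show "measure_pmf.expectation ?run (\<lambda>(S, Ps). real (card (Ps ! t))) \<le> real n * \<kappa>"
        using expected_participants_in_round[OF E, of \<kappa> t r sel] \<kappa> n by simp
    qed
  qed
  show "let F = total_value N f;
             OPT = opt_value \<I> F;
             run = federated_greedy sel E \<I> N f (sampling_rate (n, r, \<epsilon>)) r
         in measure_pmf.prob run {(S, Ps). S \<in> \<I> \<and> (1 / 2 - \<epsilon>) * OPT \<le> F S}
              \<ge> 1 - 1 / real n \<and>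
            (uniform_matroid E \<I> \<longrightarrow>
              measure_pmf.prob run {(S, Ps). S \<in> \<I> \<and> (1 - 1 / exp 1 - \<epsilon>) * OPT \<le> F S}
                \<ge> 1 - 1 / real n) \<and>
            (\<forall>t<r. measure_pmf.expectation run (\<lambda>(S, Ps). real (card (Ps ! t)))
                \<le> (case (n, r, \<epsilon>) of (n, r, \<epsilon>) \<Rightarrow> real n * sampling_rate (n, r, \<epsilon>)))"
    using goal unfolding Let_def \<kappa>_def prod.case .
qed

end
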